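(* Let $n\ge1$. There exists a bijection between the set of complete non-ambiguous forests with $n$ leaves and the set of pairs $(\alpha,\beta)$ of permutations of $\{1,\dots,n\}$ with no common rise. In particular these two sets have the same cardinality.
   Context: A non-ambiguous forest is a finite set $A\subseteq\mathbb N^+\times\mathbb N^+$ of points $p=(x(p),y(p))$ such that: (i) if some point of $A$ has first coordinate $x$ then for every $1\le x'<x$ some point of $A$ has first coordinate $x'$, and likewise for second coordinates; (ii) there is no $p\in A$ for which there exist both $q\in A$ with $x(q)=x(p)$, $y(q)<y(p)$ and $s\in A$ with $y(s)=y(p)$, $x(s)<x(p)$. It carries a rooted forest structure on vertex set $A$: the parent of $p$ is the point $q\in A$ with $x(q)=x(p)$ and $y(q)<y(p)$ maximal if such $q$ exists; otherwise the point $s\in A$ with $y(s)=y(p)$ and $x(s)<x(p)$ maximal if such $s$ exists; otherwise $p$ is a root. A leaf is a point with no children. The forest is complete if every point has either $0$ or $2$ children. For permutations $\alpha=(a_1,\dots,a_n)$, $\beta=(b_1,\dots,b_n)$ of $\{1,\dots,n\}$, the pair $(\alpha,\beta)$ has a common rise at position $i$ ($1\le i\le n-1$) if $a_i<a_{i+1}$ and $b_i<b_{i+1}$. *)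

theory Defs
  imports "HOL-Combinatorics.Permutations"
begin

type_synonym point = "nat \<times> nat"

definition same_x_below :: "point set \<Rightarrow> point \<Rightarrow> point set" where
  "same_x_below A p = {q \<in> A. fst q = fst p \<and> snd q < snd p}"

definition same_y_before :: "point set \<Rightarrow> point \<Rightarrow> point set" where
  "same_y_before A p = {s \<in> A. snd s = snd p \<and> fst s < fst p}"

definition nonambiguous_forest :: "point set \<Rightarrow> bool" where
  "nonambiguous_forest A \<longleftrightarrow>
     finite A \<and>
     (\<forall>p\<in>A. 1 \<le> fst p \<and> 1 \<le> snd p) \<and>
     (\<forall>p\<in>A. \<forall>x'. 1 \<le> x' \<and> x' < fst p \<longrightarrow> (\<exists>q\<in>A. fst q = x')) \<and>
     (\<forall>p\<in>A. \<forall>y'. 1 \<le> y' \<and> y' < snd p \<longrightarrow> (\<exists>q\<in>A. snd q = y')) \<and>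
     \<not> (\<exists>p\<in>A. same_x_below A p \<noteq> {} \<and> same_y_before A p \<noteq> {})"

text \<open>The value \<open>None\<close> means that the point is a root.\<close>

definition parent :: "point set \<Rightarrow> point \<Rightarrow> point option" where
  "parent A p =
     (if same_x_below A p \<noteq> {} then Some (fst p, Max (snd ` same_x_below A p))
      else if same_y_before A p \<noteq> {} then Some (Max (fst ` same_y_before A p), snd p)
      else None)"

definition children :: "point set \<Rightarrow> point \<Rightarrow> point set" where
  "children A p = {c \<in> A. parent A c = Some p}"

definition leaves :: "point set \<Rightarrow> point set" where
  "leaves A = {p \<in> A. children A p = {}}"

definition complete_forest :: "point set \<Rightarrow> bool" where
  "complete_forest A \<longleftrightarrow> (\<forall>p\<in>A. card (children A p) = 0 \<or> card (children A p) = 2)"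

definition complete_nonambiguous_forests :: "nat \<Rightarrow> point set set" where
  "complete_nonambiguous_forests n =
     {A. nonambiguous_forest A \<and> complete_forest A \<and> card (leaves A) = n}"

text \<open>A permutation \<open>(a\<^sub>1, \<dots>, a\<^sub>n)\<close> of \<open>{1..n}\<close> is represented by the function \<open>a\<close> with
  \<open>a permutes {1..n}\<close>, which is the identity outside \<open>{1..n}\<close>.\<close>

definition common_rise :: "(nat \<Rightarrow> nat) \<Rightarrow> (nat \<Rightarrow> nat) \<Rightarrow> nat \<Rightarrow> bool" where
  "common_rise a b i \<longleftrightarrow> a i < a (i + 1) \<and> b i < b (i + 1)"

definition perm_pairs_no_common_rise :: "nat \<Rightarrow> ((nat \<Rightarrow> nat) \<times> (nat \<Rightarrow> nat)) set" where
  "perm_pairs_no_common_rise n =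
     {(a, b). a permutes {1..n} \<and> b permutes {1..n} \<and>
        \<not> (\<exists>i. 1 \<le> i \<and> i < n \<and> common_rise a b i)}"

end

theory Submission
  imports Defs
begin

text \<open>A point has at most two children, the next point above it in its column and the next point to
  its right in its row, so in a complete forest the topmost point of each column and the rightmost
  point of each row are leaves, and the points occupy exactly \<open>n\<close> columns and \<open>n\<close> rows. On the
  other side, a pair of permutations is a word of \<open>n\<close> points with pairwise distinct columns and rows.

  By induction on the number of columns, the complete forests whose roots all lie in rows below \<open>d\<close>
  are as many as the words without common rise whose first point lies in a row below \<open>d\<close>. A word
  factors at the point \<open>(x0, c)\<close> of the first column as \<open>u (x0, c) v\<close>, where only the head of \<open>v\<close>
  is constrained: its row is below \<open>c\<close>. Removing the first column of a forest with leaf \<open>(x0, c)\<close>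
  leaves a forest with a marked set of roots below \<open>c\<close>; cutting out the marked trees yields a pair
  of forests on complementary columns and rows, in analogy to \<open>(v, u)\<close>. The bounds by \<open>d\<close> on the
  two sides agree when \<open>c < d\<close>, and otherwise after exchanging marked and unmarked trees among
  those with root row below \<open>d\<close>.\<close>

section \<open>Forests on given columns and rows, and the roots of their trees\<close>

definition nonamb :: "point set \<Rightarrow> bool" where
  "nonamb A \<longleftrightarrow> (\<forall>x y x' y'. (x, y) \<in> A \<longrightarrow> (x, y') \<in> A \<longrightarrow> (x', y) \<in> A \<longrightarrow> y' < y \<longrightarrow> x' < x \<longrightarrow> False)"

text \<open>For a non-ambiguous forest this is completeness: every point has both possible children or none.\<close>

definition balanced :: "point set \<Rightarrow> bool" where
  "balanced A \<longleftrightarrow> (\<forall>x y. (x, y) \<in> A \<longrightarrow> (\<exists>y'>y. (x, y') \<in> A) \<longleftrightarrow> (\<exists>x'>x. (x', y) \<in> A))"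

text \<open>The column set and the row set are arbitrary, not initial segments, so that removing a
  column or cutting out trees stays within the family. If both are finite, so is every
  member.\<close>

definition cforests :: "nat set \<Rightarrow> nat set \<Rightarrow> point set set" where
  "cforests X Y = {A. fst ` A = X \<and> snd ` A = Y \<and> nonamb A \<and> balanced A}"

text \<open>Roots are recorded by their rows. Nothing is lost, since a root is the leftmost point of
  its row, and sets of marked roots become sets of numbers that can be compared with bounds.\<close>

definition root_rows :: "point set \<Rightarrow> nat set" where
  "root_rows A = {y. \<exists>x. (x, y) \<in> A \<and> (\<forall>y'. (x, y') \<in> A \<longrightarrow> y \<le> y') \<and> (\<forall>x'. (x', y) \<in> A \<longrightarrow> x \<le> x')}"

lemma finite_cforests:
  assumes "finite X" "finite Y"
  shows "finite (cforests X Y)"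
proof (rule finite_subset)
  show "cforests X Y \<subseteq> Pow (X \<times> Y)"
    unfolding cforests_def by (auto simp: image_iff) force+
qed (use assms in simp)

lemma root_rows_subset: "root_rows A \<subseteq> snd ` A"
  by (force simp: root_rows_def)

text \<open>With \<open>g y\<close> the lowest row of the column of the leftmost point of row \<open>y\<close>, the iteration ends
  in the row of the root of the tree containing row \<open>y\<close>.\<close>

function iterate_down :: "(nat \<Rightarrow> nat) \<Rightarrow> nat \<Rightarrow> nat" where
  "iterate_down g y = (if g y < y then iterate_down g (g y) else y)"
  by auto
termination by (relation "measure snd") auto

declare iterate_down.simps [simp del]

text \<open>A parent shares its column or its row with its child. Hence a set of rows that is closed
  along columns cuts out a union of trees.\<close>

definition column_closed :: "point set \<Rightarrow> nat set \<Rightarrow> bool" where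
  "column_closed A S \<longleftrightarrow> (\<forall>x y y'. (x, y) \<in> A \<longrightarrow> (x, y') \<in> A \<longrightarrow> y \<in> S \<longrightarrow> y' \<in> S)"

text \<open>All points of a row lie in one tree, because a point with another to its left has none
  below it and so has its parent in its own row. \<open>R y\<close> is the root row of that tree.
  The last property says that a column-closed set of rows is determined by the roots in it; it
  follows by tracking membership along the iteration.\<close>

lemma root_map_exists:
  assumes "nonamb A"
  obtains R where "\<And>y. y \<in> snd ` A \<Longrightarrow> R y \<in> root_rows A"
    and "\<And>z. z \<in> root_rows A \<Longrightarrow> R z = z"
    and "\<And>x y y'. (x, y) \<in> A \<Longrightarrow> (x, y') \<in> A \<Longrightarrow> R y = R y'"
    and "\<And>S y. column_closed A S \<Longrightarrow> y \<in> snd ` A \<Longrightarrow> y \<in> S \<longleftrightarrow> R y \<in> S"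
proof -
  define l where "l y = (LEAST x. (x, y) \<in> A)" for y
  define b where "b x = (LEAST y. (x, y) \<in> A)" for x
  define R where "R = iterate_down (\<lambda>y. b (l y))"
  have R: "R y = (if b (l y) < y then R (b (l y)) else y)" for y
    unfolding R_def by (rule iterate_down.simps)
  have l: "(l y, y) \<in> A" "l y \<le> x" if "(x, y) \<in> A" for x y
    using that unfolding l_def by (auto intro: LeastI Least_le)
  have b: "(x, b x) \<in> A" "b x \<le> y" if "(x, y) \<in> A" for x y
    using that unfolding b_def by (auto intro: LeastI Least_le)
  have RI: "R y \<in> root_rows A \<and> (\<forall>S. column_closed A S \<longrightarrow> (y \<in> S \<longleftrightarrow> R y \<in> S))" if "y \<in> snd ` A" for y
    using that
  proof (induction y rule: less_induct)
    case (less y)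
    then have ly: "(l y, y) \<in> A" using l(1) by fastforce
    note bl = b[OF ly]
    show ?case
    proof (cases "b (l y) < y")
      case True
      have "b (l y) \<in> snd ` A" using bl(1) by force
      note IH = less.IH[OF True this]
      have "y \<in> S \<longleftrightarrow> b (l y) \<in> S" if "column_closed A S" for S
        using that ly bl(1) unfolding column_closed_def by blast
      moreover have "R y = R (b (l y))" using R[of y] True by simp
      ultimately show ?thesis using IH by simp
    next
      case False
      then have "b (l y) = y" using bl(2) by simp
      then have "y \<in> root_rows A"
        unfolding root_rows_def using ly b(2)[of "l y"] l(2) by auto
      then show ?thesis using False R[of y] by simp
    qed
  qed
  have RZ: "R z = z" if "z \<in> root_rows A" for z
  proof -
    from that obtain x where x: "(x, z) \<in> A" "\<And>y'. (x, y') \<in> A \<Longrightarrow> z \<le> y'" "\<And>x'. (x', z) \<in> A \<Longrightarrow> x \<le> x'"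
      unfolding root_rows_def by blast
    have "l z = x" using l[OF x(1)] x(3) by (meson le_antisym)
    moreover have "b x = z" using b[OF x(1)] x(2) by (meson le_antisym)
    ultimately show ?thesis by (subst R) simp
  qed
  \<comment> \<open>A point that is not the lowest of its column has, by non-ambiguity, nothing to
    its left. So \<open>l y = x\<close>, and one step of the iteration leads from \<open>y\<close>
    to \<open>b x\<close>.\<close>
  have Rb: "R y = R (b x)" if xy: "(x, y) \<in> A" for x y
  proof (cases "y = b x")
    case False
    then have lt: "b x < y" using b(2)[OF xy] by simp
    have "\<not> l y < x"
      using assms xy b(1)[OF xy] l(1)[OF xy] lt unfolding nonamb_def by blast
    then have "l y = x" using l(2)[OF xy] by simp
    then show ?thesis using R[of y] lt by simp
  qed simp
  have RC: "R y = R y'" if "(x, y) \<in> A" "(x, y') \<in> A" for x y y'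
    using Rb[OF that(1)] Rb[OF that(2)] by simp
  show thesis
    by (rule that[of R, OF conjunct1[OF RI] RZ RC conjunct2[OF RI, rule_format]])
qed

lemma root_rows_nonempty:
  assumes "A \<in> cforests X Y" "X \<noteq> {}"
  shows "root_rows A \<noteq> {}"
proof -
  from assms have "nonamb A" "snd ` A \<noteq> {}" by (auto simp: cforests_def)
  then show ?thesis using root_map_exists by (metis all_not_in_conv)
qed

subsection \<open>Splitting a forest into two\<close>

text \<open>Each of the three notions only compares points that share a column or a row, and no such
  pair meets both parts.\<close>

lemma disjoint_union_forest:
  assumes "fst ` B1 \<inter> fst ` B2 = {}" "snd ` B1 \<inter> snd ` B2 = {}"
  shows nonamb_Un: "nonamb (B1 \<union> B2) \<longleftrightarrow> nonamb B1 \<and> nonamb B2"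
    and balanced_Un: "balanced (B1 \<union> B2) \<longleftrightarrow> balanced B1 \<and> balanced B2"
    and root_rows_Un: "root_rows (B1 \<union> B2) = root_rows B1 \<union> root_rows B2"
proof -
  have x: "\<not> ((x, y) \<in> B1 \<and> (x, y') \<in> B2)" for x y y'
    using assms(1) by force
  have y: "\<not> ((x, y) \<in> B1 \<and> (x', y) \<in> B2)" for x x' y
    using assms(2) by force
  show "nonamb (B1 \<union> B2) \<longleftrightarrow> nonamb B1 \<and> nonamb B2"
    unfolding nonamb_def Un_iff using x y by meson
  show "balanced (B1 \<union> B2) \<longleftrightarrow> balanced B1 \<and> balanced B2"
  proof -
    have "((\<exists>y'>y. (a, y') \<in> B1 \<union> B2) \<longleftrightarrow> (\<exists>y'>y. (a, y') \<in> B1)) \<and>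
        ((\<exists>x'>a. (x', y) \<in> B1 \<union> B2) \<longleftrightarrow> (\<exists>x'>a. (x', y) \<in> B1))" if "(a, y) \<in> B1" for a y
      using x y that by blast
    moreover have "((\<exists>y'>y. (a, y') \<in> B1 \<union> B2) \<longleftrightarrow> (\<exists>y'>y. (a, y') \<in> B2)) \<and>
        ((\<exists>x'>a. (x', y) \<in> B1 \<union> B2) \<longleftrightarrow> (\<exists>x'>a. (x', y) \<in> B2))" if "(a, y) \<in> B2" for a y
      using x y that by blast
    ultimately show ?thesis unfolding balanced_def by (simp add: ball_Un imp_conjR all_conj_distrib imp_disjL) 
  qed
  show "root_rows (B1 \<union> B2) = root_rows B1 \<union> root_rows B2"
    unfolding root_rows_def Un_iff using x y by blast
qed

text \<open>Marking a set \<open>C\<close> of roots separates the marked trees from the unmarked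
  ones, and these form two forests on complementary columns and rows. Conversely, any two such
  forests have a union whose marks are the roots of the first. The predicates \<open>P\<close> and
  \<open>Q\<close> then constrain the two factors independently.\<close>

lemma card_marked_forests:
  assumes fin: "finite X" "finite Y"
  shows "card {(B, C). B \<in> cforests X Y \<and> C \<subseteq> root_rows B \<and> P C \<and> Q (root_rows B - C)} =
    (\<Sum>(X1, Y1)\<in>Pow X \<times> Pow Y. card {B \<in> cforests X1 Y1. P (root_rows B)} *
       card {B \<in> cforests (X - X1) (Y - Y1). Q (root_rows B)})"
proof -
  let ?S = "Sigma (Pow X \<times> Pow Y) (\<lambda>(X1, Y1). {B \<in> cforests X1 Y1. P (root_rows B)} \<times>
       {B \<in> cforests (X - X1) (Y - Y1). Q (root_rows B)})"
  let ?f = "\<lambda>((X1 :: nat set, Y1 :: nat set), (B1, B2)). (B1 \<union> B2, root_rows B1)"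
  let ?T = "{(B, C). B \<in> cforests X Y \<and> C \<subseteq> root_rows B \<and> P C \<and> Q (root_rows B - C)}"
  \<comment> \<open>The rows of the marked part are those whose tree has a marked root. As
    \<open>R\<close> depends only on the union, two decompositions of the same forest with the same
    marks can be compared through one \<open>R\<close>.\<close>
  have cut: "snd ` B1 = {y \<in> snd ` (B1 \<union> B2). R y \<in> root_rows B1}"
    if d: "fst ` B1 \<inter> fst ` B2 = {}" "snd ` B1 \<inter> snd ` B2 = {}"
      and R1: "\<And>y. y \<in> snd ` (B1 \<union> B2) \<Longrightarrow> R y \<in> root_rows (B1 \<union> B2)"
      and R2: "\<And>S y. column_closed (B1 \<union> B2) S \<Longrightarrow> y \<in> snd ` (B1 \<union> B2) \<Longrightarrow> y \<in> S \<longleftrightarrow> R y \<in> S"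
    for B1 B2 R
  proof -
    have "column_closed (B1 \<union> B2) (snd ` B1)"
      unfolding column_closed_def
    proof (intro allI impI)
      fix x y y' assume a: "(x, y) \<in> B1 \<union> B2" "(x, y') \<in> B1 \<union> B2" "y \<in> snd ` B1"
      then have "(x, y) \<in> B1" using d(2) by force
      then have "(x, y') \<in> B1" using a(2) d(1) by force
      then show "y' \<in> snd ` B1" by force
    qed
    then have "y \<in> snd ` B1 \<longleftrightarrow> R y \<in> snd ` B1" if "y \<in> snd ` (B1 \<union> B2)" for y
      using R2 that by blast
    moreover have "R y \<in> snd ` B1 \<longleftrightarrow> R y \<in> root_rows B1" if "y \<in> snd ` (B1 \<union> B2)" for y
      using R1[OF that] d(2) root_rows_subset[of B1] root_rows_subset[of B2]
      unfolding root_rows_Un[OF d] by blast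
    moreover have "snd ` B1 \<subseteq> snd ` (B1 \<union> B2)" by (simp add: image_Un)
    ultimately show ?thesis
      by (intro set_eqI) (metis (no_types, lifting) mem_Collect_eq subsetD)
  qed
  have split: "fst ` B1 \<inter> fst ` B2 = {}" "snd ` B1 \<inter> snd ` B2 = {}"
    if "B1 \<in> cforests X1 Y1" "B2 \<in> cforests (X - X1) (Y - Y1)" for B1 B2 X1 Y1
    using that by (auto simp: cforests_def)
  have diff: "Z1 \<union> Z2 - Z1 = Z2" if "Y1 \<inter> Y2 = {}" "Z1 \<subseteq> Y1" "Z2 \<subseteq> Y2" for Z1 Z2 Y1 Y2 :: "nat set"
    using that by blast
  have inj: "inj_on ?f ?S"
  proof (rule inj_onI)
    fix p q assume pq: "p \<in> ?S" "q \<in> ?S" "?f p = ?f q"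
    obtain X1 Y1 B1 B2 where p: "p = ((X1, Y1), (B1, B2))"
      and m: "B1 \<in> cforests X1 Y1" "B2 \<in> cforests (X - X1) (Y - Y1)"
      using pq(1) by auto
    obtain X1' Y1' B1' B2' where q: "q = ((X1', Y1'), (B1', B2'))"
      and m': "B1' \<in> cforests X1' Y1'" "B2' \<in> cforests (X - X1') (Y - Y1')"
      using pq(2) by auto
    have eq: "B1 \<union> B2 = B1' \<union> B2'" "root_rows B1 = root_rows B1'"
      using pq(3) p q by auto
    note s = split[OF m] and s' = split[OF m']
    have na: "nonamb (B1 \<union> B2)"
      using m nonamb_Un[OF s] by (auto simp: cforests_def)
    obtain R where R: "\<And>y. y \<in> snd ` (B1 \<union> B2) \<Longrightarrow> R y \<in> root_rows (B1 \<union> B2)"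
      "\<And>z. z \<in> root_rows (B1 \<union> B2) \<Longrightarrow> R z = z"
      "\<And>x y y'. (x, y) \<in> B1 \<union> B2 \<Longrightarrow> (x, y') \<in> B1 \<union> B2 \<Longrightarrow> R y = R y'"
      "\<And>S y. column_closed (B1 \<union> B2) S \<Longrightarrow> y \<in> snd ` (B1 \<union> B2) \<Longrightarrow> y \<in> S \<longleftrightarrow> R y \<in> S"
      by (fact root_map_exists[OF na])
    have "snd ` B1 = {y \<in> snd ` (B1 \<union> B2). R y \<in> root_rows B1}"
      by (rule cut[OF s R(1,4)])
    also have "\<dots> = {y \<in> snd ` (B1' \<union> B2'). R y \<in> root_rows B1'}" using eq by simp
    also have "\<dots> = snd ` B1'"
      by (rule cut[OF s' R(1,4)[unfolded eq(1)], symmetric])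
    finally have Y: "snd ` B1 = snd ` B1'" .
    have "B1 = {p \<in> B1 \<union> B2. snd p \<in> snd ` B1}" using s by auto
    also have "\<dots> = {p \<in> B1' \<union> B2'. snd p \<in> snd ` B1'}" using Y eq by simp
    also have "\<dots> = B1'" using s' by auto
    finally have B1: "B1 = B1'" .
    have "B2 = (B1 \<union> B2) - B1" using s by auto
    also have "\<dots> = (B1' \<union> B2') - B1'" using eq B1 by simp
    also have "\<dots> = B2'" using s' by auto
    finally show "p = q" using p q B1 m m' by (auto simp: cforests_def)
  qed
  have img: "?f ` ?S = ?T"
  proof (intro equalityI subsetI)
    fix t assume "t \<in> ?f ` ?S"
    then obtain X1 Y1 B1 B2 where t: "t = (B1 \<union> B2, root_rows B1)" "X1 \<subseteq> X" "Y1 \<subseteq> Y"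
      and m: "B1 \<in> cforests X1 Y1" "B2 \<in> cforests (X - X1) (Y - Y1)"
      and PQ: "P (root_rows B1)" "Q (root_rows B2)" by auto
    note s = split[OF m]
    have "B1 \<union> B2 \<in> cforests X Y"
      using m t(2,3) nonamb_Un[OF s] balanced_Un[OF s]
      by (auto simp: cforests_def image_Un)
    moreover have "root_rows (B1 \<union> B2) - root_rows B1 = root_rows B2"
      unfolding root_rows_Un[OF s] by (rule diff[OF s(2) root_rows_subset root_rows_subset])
    ultimately show "t \<in> ?T" using t PQ root_rows_Un[OF s] by auto
  next
    fix t assume "t \<in> ?T"
    then obtain B C where t: "t = (B, C)" and B: "B \<in> cforests X Y" and C: "C \<subseteq> root_rows B"
      and PQ: "P C" "Q (root_rows B - C)" by auto
    have na: "nonamb B" using B by (auto simp: cforests_def)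
    obtain R where R: "\<And>y. y \<in> snd ` B \<Longrightarrow> R y \<in> root_rows B"
      "\<And>z. z \<in> root_rows B \<Longrightarrow> R z = z"
      "\<And>x y y'. (x, y) \<in> B \<Longrightarrow> (x, y') \<in> B \<Longrightarrow> R y = R y'"
      "\<And>S y. column_closed B S \<Longrightarrow> y \<in> snd ` B \<Longrightarrow> y \<in> S \<longleftrightarrow> R y \<in> S"
      by (fact root_map_exists[OF na])
    \<comment> \<open>The inverse construction: collect the trees with marked root. Since
      \<open>R\<close> is constant along columns, the two parts share no column either.\<close>
    define B1 where "B1 = {p \<in> B. R (snd p) \<in> C}"
    define B2 where "B2 = {p \<in> B. R (snd p) \<notin> C}"
    have BU: "B = B1 \<union> B2" by (auto simp: B1_def B2_def)
    have s: "fst ` B1 \<inter> fst ` B2 = {}" "snd ` B1 \<inter> snd ` B2 = {}"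
    proof -
      have "x \<noteq> x'" if "(x, y) \<in> B1" "(x', y') \<in> B2" for x y x' y'
        using that R(3)[of x y y'] by (auto simp: B1_def B2_def)
      then show "fst ` B1 \<inter> fst ` B2 = {}" by fastforce
      show "snd ` B1 \<inter> snd ` B2 = {}" by (auto simp: B1_def B2_def)
    qed
    have roots: "root_rows B = root_rows B1 \<union> root_rows B2"
      using root_rows_Un[OF s] BU by simp
    have C1: "root_rows B1 = C"
    proof
      show "root_rows B1 \<subseteq> C"
      proof
        fix z assume z: "z \<in> root_rows B1"
        then have "R z = z" using R(2) roots by blast
        moreover have "z \<in> snd ` B1" using z root_rows_subset by blast
        ultimately show "z \<in> C" by (auto simp: B1_def)
      qed
      show "C \<subseteq> root_rows B1"
      proof
        fix z assume z: "z \<in> C"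
        then have "R z \<in> C" using C R(2) by auto
        then have "z \<notin> snd ` B2" by (auto simp: B2_def)
        then show "z \<in> root_rows B1" using z C roots root_rows_subset[of B2] by blast
      qed
    qed
    have "root_rows B2 = root_rows B - C"
      using diff[OF s(2) root_rows_subset root_rows_subset] roots C1 by simp
    moreover have "B1 \<in> cforests (fst ` B1) (snd ` B1)" "B2 \<in> cforests (X - fst ` B1) (Y - snd ` B1)"
      using B BU s nonamb_Un[OF s] balanced_Un[OF s] by (auto simp: cforests_def image_Un)
    moreover have "fst ` B1 \<subseteq> X" "snd ` B1 \<subseteq> Y" using B BU by (auto simp: cforests_def)
    ultimately have "((fst ` B1, snd ` B1), (B1, B2)) \<in> ?S" using C1 PQ by auto
    moreover have "t = ?f ((fst ` B1, snd ` B1), (B1, B2))" using t BU C1 by simp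
    ultimately show "t \<in> ?f ` ?S" by blast
  qed
  have "card ?T = card ?S" using card_image[OF inj] img by simp
  also have "\<dots> = (\<Sum>q\<in>Pow X \<times> Pow Y. card (case q of (X1, Y1) \<Rightarrow> {B \<in> cforests X1 Y1. P (root_rows B)} \<times>
       {B \<in> cforests (X - X1) (Y - Y1). Q (root_rows B)}))"
    by (rule card_SigmaI)
      (use fin in \<open>auto intro!: finite_cartesian_product finite_subset[OF _ finite_cforests] dest: finite_subset\<close>)
  also have "\<dots> = (\<Sum>(X1, Y1)\<in>Pow X \<times> Pow Y. card {B \<in> cforests X1 Y1. P (root_rows B)} *
       card {B \<in> cforests (X - X1) (Y - Y1). Q (root_rows B)})"
    by (rule sum.cong) (auto simp: card_cartesian_product)
  finally show ?thesis .
qed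


subsection \<open>Removing the first column of a forest\<close>

text \<open>The new column lies to the left of everything. Its top \<open>(x0, c)\<close> is alone
  in its row and becomes a leaf; each lower point, in a row of \<open>C\<close>, has a point above
  it and the old root of its row to its right. The marked trees are thus hung onto the new column,
  whose lowest point is the only new root.\<close>

lemma add_column:
  assumes B: "B \<in> cforests X (Y - {c})" and c: "c \<in> Y" and x0: "\<And>x. x \<in> X \<Longrightarrow> x0 < x"
    and C: "C \<subseteq> root_rows B" "\<And>z. z \<in> C \<Longrightarrow> z < c"
  shows add_column_forest: "B \<union> {x0} \<times> insert c C \<in> cforests (insert x0 X) Y"
    and root_rows_add_column:
      "root_rows (B \<union> {x0} \<times> insert c C) = insert (Min (insert c C)) (root_rows B - C)"
proof -
  let ?A = "B \<union> {x0} \<times> insert c C"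
  have BX: "x0 < x" "x \<in> X" and BY: "y \<in> Y" "y \<noteq> c" if "(x, y) \<in> B" for x y
    using B that x0 by (force simp: cforests_def)+
  have CB: "z \<in> snd ` B" if "z \<in> C" for z using that C root_rows_subset by blast
  have na: "nonamb B" and ba: "balanced B" and XY: "fst ` B = X" "snd ` B = Y - {c}"
    using B by (auto simp: cforests_def)
  have mem: "(x, y) \<in> ?A \<longleftrightarrow> (x, y) \<in> B \<or> x = x0 \<and> (y = c \<or> y \<in> C)" for x y by auto
  \<comment> \<open>The points in a row of \<open>C\<close> acquire a left neighbor in the new
    column, so none of them may have a point below it. For the root this is its definition; the
    others already had the root to their left.\<close>
  have root: "y \<le> y'" if "(x, y) \<in> B" "(x, y') \<in> B" "y \<in> C" for x y y'
  proof (rule ccontr)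
    assume ne: "\<not> y \<le> y'"
    from C(1) that(3) obtain a where a: "(a, y) \<in> B" "\<And>y'. (a, y') \<in> B \<Longrightarrow> y \<le> y'" "\<And>x'. (x', y) \<in> B \<Longrightarrow> a \<le> x'"
      unfolding root_rows_def by blast
    then have "a < x" using that ne by (metis le_neq_implies_less)
    then show False using na that a(1) ne unfolding nonamb_def by (metis not_le)
  qed
  have "nonamb ?A"
    unfolding nonamb_def
  proof (intro allI impI)
    fix x y x' y'
    assume a: "(x, y) \<in> ?A" "(x, y') \<in> ?A" "(x', y) \<in> ?A" and lt: "y' < y" "x' < x"
    have "x \<noteq> x0" using a(3) lt(2) BX(1) unfolding mem by fastforce
    then have b: "(x, y) \<in> B" "(x, y') \<in> B" using a mem by auto
    then have "(x', y) \<notin> B" using na lt unfolding nonamb_def by blast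
    then have "y \<in> C" using a(3) b BY(2) unfolding mem by blast
    then show False using root[OF b] lt by simp
  qed
  moreover have "balanced ?A"
    unfolding balanced_def
  proof (intro allI impI)
    fix x y assume a: "(x, y) \<in> ?A"
    show "(\<exists>y'>y. (x, y') \<in> ?A) \<longleftrightarrow> (\<exists>x'>x. (x', y) \<in> ?A)"
    proof (cases "x = x0")
      case False
      then have "(x, y) \<in> B" using a mem by blast
      moreover from this have "x0 < x" using BX by blast
      ultimately show ?thesis using ba unfolding balanced_def mem by (metis less_asym)
    next
      case True
      then have "y = c \<or> y \<in> C" using a BX(1) mem by blast
      then show ?thesis
      proof
        assume "y = c"
        then show ?thesis unfolding mem using True BX BY C(2)
          by (metis less_asym less_irrefl)
      next
        assume y: "y \<in> C"
        then obtain x' where "(x', y) \<in> B" using CB by fastforce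
        then have "\<exists>x'>x. (x', y) \<in> ?A" using BX True mem by blast
        moreover have "\<exists>y'>y. (x, y') \<in> ?A" using y C(2) True mem by blast
        ultimately show ?thesis by blast
      qed
    qed
  qed
  moreover have "fst ` ?A = insert x0 X" using XY by (auto simp: image_Un)
  moreover have "snd ` ?A = Y"
  proof -
    have "snd ` ?A = (Y - {c}) \<union> insert c C" using XY by (simp add: image_Un)
    also have "\<dots> = Y" using CB XY c by auto
    finally show ?thesis .
  qed
  ultimately show "?A \<in> cforests (insert x0 X) Y" by (simp add: cforests_def)
  define m where "m = Min (insert c C)"
  have fin: "finite C" by (rule finite_subset[of _ "{..<c}"]) (use C in auto)
  have m: "m = c \<or> m \<in> C" "\<And>y. y = c \<or> y \<in> C \<Longrightarrow> m \<le> y"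
    using Min_in[of "insert c C"] fin unfolding m_def by auto
  have "y \<in> root_rows ?A \<longleftrightarrow> y = m \<or> y \<in> root_rows B - C" for y
  proof (cases "y = c \<or> y \<in> C")
    case True
    have "y \<in> root_rows ?A \<longleftrightarrow> y = m"
    proof
      assume "y \<in> root_rows ?A"
      then obtain x where x: "(x, y) \<in> ?A" "\<And>y'. (x, y') \<in> ?A \<Longrightarrow> y \<le> y'" "\<And>x'. (x', y) \<in> ?A \<Longrightarrow> x \<le> x'"
        unfolding root_rows_def by blast
      have "x \<le> x0" using x(3) True mem by blast
      then have "x = x0" using x(1) BX unfolding mem by force
      then have "y \<le> m" using x(2) m mem by blast
      then show "y = m" using m(2) True by force
    next
      assume y: "y = m"
      have "y \<le> y'" if "(x0, y') \<in> ?A" for y'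
        using that m(2) y BX(1) unfolding mem by blast
      moreover have "x0 \<le> x'" if "(x', y) \<in> ?A" for x'
        using that BX(1) unfolding mem by force
      moreover have "(x0, y) \<in> ?A" using True mem by blast
      ultimately show "y \<in> root_rows ?A" unfolding root_rows_def by blast
    qed
    moreover have "c \<notin> root_rows B" using root_rows_subset XY by blast
    ultimately show ?thesis using True by blast
  next
    case False
    then have row: "(x, y) \<in> ?A \<longleftrightarrow> (x, y) \<in> B" for x using mem by blast
    have col: "(x, y') \<in> ?A \<longleftrightarrow> (x, y') \<in> B" if "(x, y) \<in> B" for x y' using mem BX[OF that] by blast
    have "y \<in> root_rows ?A \<longleftrightarrow> y \<in> root_rows B"
      unfolding root_rows_def mem_Collect_eq row using col by metis
    then show ?thesis using False m(1) by blast
  qed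
  then show "root_rows ?A = insert (Min (insert c C)) (root_rows B - C)"
    unfolding m_def by blast
qed

text \<open>This reverses the preceding construction: \<open>c\<close> is the top row of the first
  column, \<open>C\<close> consists of the other rows in that column, and \<open>B\<close> is the
  rest of the forest.\<close>

lemma remove_column:
  assumes A: "A \<in> cforests (insert x0 X) Y" and fin: "finite Y" and x0: "\<And>x. x \<in> X \<Longrightarrow> x0 < x"
  obtains c B C where "c \<in> Y" "B \<in> cforests X (Y - {c})" "C \<subseteq> root_rows B" "\<And>z. z \<in> C \<Longrightarrow> z < c"
    "A = B \<union> {x0} \<times> insert c C"
proof -
  define K where "K = {y. (x0, y) \<in> A}"
  define c where "c = Max K"
  define C where "C = K - {c}"
  define B where "B = {p \<in> A. fst p \<noteq> x0}"
  have na: "nonamb A" and ba: "balanced A" and XY: "fst ` A = insert x0 X" "snd ` A = Y"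
    using A by (auto simp: cforests_def)
  have KY: "K \<subseteq> Y" using XY by (force simp: K_def)
  then have finK: "finite K" using fin finite_subset by blast
  have "x0 \<in> fst ` A" using XY by simp
  then have "K \<noteq> {}" by (force simp: K_def)
  then have cK: "c \<in> K" using finK unfolding c_def by simp
  have cmax: "y \<le> c" if "y \<in> K" for y using that finK unfolding c_def by simp
  have xmin: "x0 \<le> x" if "(x, y) \<in> A" for x y
  proof -
    have "x \<in> insert x0 X" using that XY(1) by force
    then show ?thesis using x0 by force
  qed
  have c: "(x0, c) \<in> A" using cK by (simp add: K_def)
  \<comment> \<open>Nothing lies above \<open>(x0, c)\<close>, so by balance nothing lies to its
    right; row \<open>c\<close> disappears with the column.\<close>
  have row_c: "x = x0" if "(x, c) \<in> A" for x
  proof (rule ccontr)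
    assume "x \<noteq> x0"
    then have "\<exists>x'>x0. (x', c) \<in> A" using xmin[OF that] that by (intro exI[of _ x]) simp
    then obtain y where "y > c" "(x0, y) \<in> A" using c ba unfolding balanced_def by blast
    then show False using cmax[of y] by (simp add: K_def)
  qed
  have memB: "(x, y) \<in> B \<longleftrightarrow> (x, y) \<in> A \<and> x \<noteq> x0" for x y by (auto simp: B_def)
  \<comment> \<open>A lower point of the first column has \<open>(x0, c)\<close> above it, hence by
    balance a point to its right, so its row survives.\<close>
  have right: "\<exists>x. (x, y) \<in> B" if y: "y \<in> Y - {c}" for y
  proof -
    obtain x where x: "(x, y) \<in> A" using y XY(2) by fastforce
    show ?thesis
    proof (cases "x = x0")
      case True
      then have "y < c" using cmax[of y] x y by (simp add: K_def)
      then obtain x' where "x' > x" "(x', y) \<in> A"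
        using ba x c True unfolding balanced_def by blast
      then show ?thesis using True memB by blast
    qed (use x memB in blast)
  qed
  have "B \<in> cforests X (Y - {c})"
  proof -
    have "fst ` B = fst ` A - {x0}" by (auto simp: B_def)
    also have "\<dots> = X" using XY(1) x0 by auto
    finally have "fst ` B = X" .
    moreover have "snd ` B = Y - {c}"
    proof
      show "snd ` B \<subseteq> Y - {c}" using XY(2) row_c by (force simp: B_def)
      show "Y - {c} \<subseteq> snd ` B" using right by force
    qed
    moreover have "nonamb B" using na unfolding nonamb_def memB by blast
    moreover have "balanced B" unfolding balanced_def
    proof (intro allI impI)
      fix x y assume a: "(x, y) \<in> B"
      then have "x0 < x" using xmin[of x y] memB[of x y] by simp
      then show "(\<exists>y'>y. (x, y') \<in> B) \<longleftrightarrow> (\<exists>x'>x. (x', y) \<in> B)"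
        using ba a unfolding balanced_def memB by (metis less_asym)
    qed
    ultimately show ?thesis by (simp add: cforests_def)
  qed
  \<comment> \<open>The leftmost remaining point of a row in \<open>C\<close> had
    \<open>(x0, y)\<close> to its left, so by non-ambiguity it has nothing below it and is now a
    root.\<close>
  moreover have "C \<subseteq> root_rows B"
  proof
    fix y assume y: "y \<in> C"
    then have yA: "(x0, y) \<in> A" and "y \<in> Y - {c}" using KY by (auto simp: C_def K_def)
    then obtain x1 where x1: "(x1, y) \<in> B" using right by blast
    define x where "x = (LEAST x. (x, y) \<in> B)"
    have x: "(x, y) \<in> B" unfolding x_def using x1 by (rule LeastI)
    have "x \<le> x'" if "(x', y) \<in> B" for x' unfolding x_def using that by (rule Least_le)
    moreover have "y \<le> y'" if "(x, y') \<in> B" for y'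
    proof (rule ccontr)
      assume "\<not> y \<le> y'"
      moreover have "x0 < x" using xmin[of x y] x memB[of x y] by simp
      ultimately show False using na x that yA unfolding nonamb_def memB by (meson not_le)
    qed
    ultimately show "y \<in> root_rows B" unfolding root_rows_def using x by blast
  qed
  moreover have "z < c" if "z \<in> C" for z using that cmax[of z] by (auto simp: C_def)
  moreover have "A = B \<union> {x0} \<times> insert c C" using cK by (auto simp: B_def C_def K_def)
  moreover have "c \<in> Y" using cK KY by blast
  ultimately show thesis using that by metis
qed

text \<open>A forest corresponds to its first column, given by the top \<open>c\<close> and the
  marks \<open>C\<close>, together with the remaining forest \<open>B\<close>. Its roots are the
  unmarked roots of \<open>B\<close> and the minimum of \<open>insert c C\<close>; the existential
  condition says that this minimum is below \<open>d\<close>.\<close>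

lemma card_forests_step:
  assumes fin: "finite X" "finite Y" and x0: "\<And>x. x \<in> X \<Longrightarrow> x0 < x"
  shows "card {A \<in> cforests (insert x0 X) Y. \<forall>z\<in>root_rows A. z < d} =
    (\<Sum>c\<in>Y. card {(B, C). B \<in> cforests X (Y - {c}) \<and> C \<subseteq> root_rows B \<and> (\<forall>z\<in>C. z < c) \<and>
       (\<forall>z\<in>root_rows B - C. z < d) \<and> (\<exists>z\<in>insert c C. z < d)})"
proof -
  let ?M = "\<lambda>c. {(B, C). B \<in> cforests X (Y - {c}) \<and> C \<subseteq> root_rows B \<and> (\<forall>z\<in>C. z < c) \<and>
       (\<forall>z\<in>root_rows B - C. z < d) \<and> (\<exists>z\<in>insert c C. z < d)}"
  let ?f = "\<lambda>(c, B, C). B \<union> {x0} \<times> insert c C"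
  let ?T = "{A \<in> cforests (insert x0 X) Y. \<forall>z\<in>root_rows A. z < d}"
  have roots: "(\<forall>z\<in>root_rows (B \<union> {x0} \<times> insert c C). z < d) \<longleftrightarrow>
      (\<forall>z\<in>root_rows B - C. z < d) \<and> (\<exists>z\<in>insert c C. z < d)"
    if "B \<in> cforests X (Y - {c})" "c \<in> Y" "C \<subseteq> root_rows B" "\<And>z. z \<in> C \<Longrightarrow> z < c" for B c C
  proof -
    have "finite (insert c C)" using finite_subset[of C "{..<c}"] that(4) by auto
    then have "Min (insert c C) < d \<longleftrightarrow> (\<exists>z\<in>insert c C. z < d)"
      by (intro Min_less_iff) auto
    moreover have "root_rows (B \<union> {x0} \<times> insert c C) = insert (Min (insert c C)) (root_rows B - C)"
      using root_rows_add_column[OF that(1,2) x0 that(3,4)] by blast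
    ultimately show ?thesis by auto
  qed
  have inj: "inj_on ?f (Sigma Y ?M)"
  proof (rule inj_onI)
    fix p q assume pq: "p \<in> Sigma Y ?M" "q \<in> Sigma Y ?M" "?f p = ?f q"
    obtain c B C where p: "p = (c, B, C)" "B \<in> cforests X (Y - {c})" "\<forall>z\<in>C. z < c"
      using pq(1) by auto
    obtain c' B' C' where q: "q = (c', B', C')" "B' \<in> cforests X (Y - {c'})" "\<forall>z\<in>C'. z < c'"
      using pq(2) by auto
    note m = p(2) q(2) and C = p(3) q(3)
    have eq: "B \<union> {x0} \<times> insert c C = B' \<union> {x0} \<times> insert c' C'"
      using pq(3) p(1) q(1) by simp
    have x: "x \<noteq> x0" if "(x, y) \<in> B \<union> B'" for x y
    proof -
      have "x \<in> fst ` B \<union> fst ` B'" using that by force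
      then have "x \<in> X" using m by (simp add: cforests_def)
      then show ?thesis using x0 by blast
    qed
    have eq': "(x, y) \<in> B \<or> x = x0 \<and> y \<in> insert c C \<longleftrightarrow> (x, y) \<in> B' \<or> x = x0 \<and> y \<in> insert c' C'" for x y
      using eq by auto
    have "y \<in> insert c C \<longleftrightarrow> y \<in> insert c' C'" for y
      using eq'[of x0 y] x by blast
    then have K: "insert c C = insert c' C'" by blast
    have "c \<le> c'" "c' \<le> c" using C K by (metis insertE insertI1 less_imp_le order_refl)+
    then have "c = c'" by simp
    moreover have "C = C'" using K C \<open>c = c'\<close> by (metis insert_ident less_irrefl)
    moreover have "B = B'"
    proof -
      have "(a, b) \<in> B \<longleftrightarrow> (a, b) \<in> B'" for a b using eq'[of a b] x[of a b] by blast
      then show ?thesis by auto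
    qed
    ultimately show "p = q" using p(1) q(1) by blast
  qed
  have img: "?f ` Sigma Y ?M = ?T"
  proof (intro equalityI subsetI)
    fix A assume "A \<in> ?f ` Sigma Y ?M"
    then obtain c B C where A: "A = B \<union> {x0} \<times> insert c C" "c \<in> Y" "(B, C) \<in> ?M c" by auto
    then show "A \<in> ?T" using add_column_forest[of B X Y c x0 C] x0 roots[of B c C] by auto
  next
    fix A assume A: "A \<in> ?T"
    then obtain c B C where *: "c \<in> Y" "B \<in> cforests X (Y - {c})" "C \<subseteq> root_rows B" "\<And>z. z \<in> C \<Longrightarrow> z < c"
      "A = B \<union> {x0} \<times> insert c C"
      using remove_column[of A x0 X Y] fin x0 by blast
    then have "(B, C) \<in> ?M c" using roots[OF *(2,1,3,4)] A by auto
    then show "A \<in> ?f ` Sigma Y ?M" using * by (intro image_eqI[of _ _ "(c, B, C)"]) auto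
  qed
  have "card ?T = card (Sigma Y ?M)" using card_image[OF inj] unfolding img .
  also have "\<dots> = (\<Sum>c\<in>Y. card (?M c))"
  proof (rule card_SigmaI)
    show "\<forall>c\<in>Y. finite (?M c)"
    proof
      fix c
      have "?M c \<subseteq> cforests X (Y - {c}) \<times> Pow Y"
      proof
        fix p assume "p \<in> ?M c"
        then obtain B C where p: "p = (B, C)" "B \<in> cforests X (Y - {c})" "C \<subseteq> root_rows B" by auto
        have "root_rows B \<subseteq> Y - {c}" using root_rows_subset[of B] p(2) by (simp add: cforests_def)
        then show "p \<in> cforests X (Y - {c}) \<times> Pow Y" using p by blast
      qed
      then show "finite (?M c)" by (rule finite_subset) (use fin finite_cforests in simp)
    qed
  qed (rule fin)
  finally show ?thesis .
qed

section \<open>Exchanging marked and unmarked roots\<close>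

text \<open>For \<open>c < d\<close> both final conditions hold automatically. For
  \<open>d \<le> c\<close> the left one asks for a mark below \<open>d\<close> and the right one for
  an unmarked element, which is itself below \<open>d\<close>. Exchanging the two kinds below
  \<open>d\<close> turns one condition into the other, and the new marks stay below \<open>c\<close>
  because \<open>d \<le> c\<close>.\<close>

lemma card_swap_marks:
  fixes c d :: nat and Z :: "'a \<Rightarrow> nat set"
  shows "card {(B, C). B \<in> M \<and> C \<subseteq> Z B \<and> (\<forall>z\<in>C. z < c) \<and> (\<forall>z\<in>Z B - C. z < d) \<and> (\<exists>z\<in>insert c C. z < d)} =
    card {(B, C). B \<in> M \<and> C \<subseteq> Z B \<and> (\<forall>z\<in>C. z < c) \<and> (\<forall>z\<in>Z B - C. z < d) \<and> (Z B - C = {} \<longrightarrow> c < d)}"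
    (is "card ?S = card ?T")
proof (cases "c < d")
  case True
  then have "?S = ?T" by auto
  then show ?thesis by simp
next
  case False
  \<comment> \<open>Marks at or above \<open>d\<close> are forced; complementing those below \<open>d\<close> is an involution.\<close>
  let ?f = "\<lambda>(B, C). (B, {z \<in> C. d \<le> z} \<union> (Z B - C))"
  have "bij_betw ?f ?S ?T"
  proof (rule bij_betw_byWitness[where f' = ?f])
    have "{z \<in> {z \<in> C. d \<le> z} \<union> (W - C). d \<le> z} \<union> (W - ({z \<in> C. d \<le> z} \<union> (W - C))) = C"
      if "C \<subseteq> W" "\<forall>z\<in>W - C. z < d" for C W :: "nat set"
      using that by (auto simp: not_le dest: bspec leD)
    then show "\<forall>p\<in>?S. ?f (?f p) = p" "\<forall>p\<in>?T. ?f (?f p) = p" by auto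
    have "{z \<in> C. d \<le> z} \<union> (W - C) \<subseteq> W \<and> (\<forall>z\<in>{z \<in> C. d \<le> z} \<union> (W - C). z < c) \<and>
        (\<forall>z\<in>W - ({z \<in> C. d \<le> z} \<union> (W - C)). z < d) \<and>
        (W - C \<noteq> {} \<longrightarrow> (\<exists>z\<in>{z \<in> C. d \<le> z} \<union> (W - C). z < d)) \<and>
        ((\<exists>z\<in>C. z < d) \<longrightarrow> W - ({z \<in> C. d \<le> z} \<union> (W - C)) \<noteq> {})"
      if "C \<subseteq> W" "\<forall>z\<in>C. z < c" "\<forall>z\<in>W - C. z < d" for C W :: "nat set"
      using that False by (intro conjI) (auto simp: not_le not_less intro: less_le_trans)
    note swap = this
    show "?f ` ?S \<subseteq> ?T"
    proof
      fix p assume "p \<in> ?f ` ?S"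
      then obtain B C where p: "p = ?f (B, C)" "(B, C) \<in> ?S" by auto
      then show "p \<in> ?T" using swap[of C "Z B"] False by simp
    qed
    show "?f ` ?T \<subseteq> ?S"
    proof
      fix p assume "p \<in> ?f ` ?T"
      then obtain B C where p: "p = ?f (B, C)" "(B, C) \<in> ?T" by auto
      then show "p \<in> ?S" using swap[of C "Z B"] False by simp
    qed
  qed
  then show ?thesis by (rule bij_betw_same_card)
qed


subsection \<open>Words without common rises\<close>

definition no_rise :: "point \<Rightarrow> point \<Rightarrow> bool" where
  "no_rise p q \<longleftrightarrow> \<not> (fst p < fst q \<and> snd p < snd q)"

text \<open>The columns and rows are arbitrary here too, so that the factors of a word are again
  words.\<close>

definition words :: "nat set \<Rightarrow> nat set \<Rightarrow> point list set" where
  "words X Y = {w. distinct (map fst w) \<and> fst ` set w = X \<and> distinct (map snd w) \<and> snd ` set w = Y \<and>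
     successively no_rise w}"

lemma finite_words:
  assumes "finite X" "finite Y"
  shows "finite (words X Y)"
proof (rule finite_subset)
  show "words X Y \<subseteq> {w. set w \<subseteq> X \<times> Y \<and> length w \<le> card X}"
  proof
    fix w assume w: "w \<in> words X Y"
    then have "set w \<subseteq> X \<times> Y" by (force simp: words_def)
    moreover have "length w = card X"
      using w distinct_card[of "map fst w"] by (simp add: words_def)
    ultimately show "w \<in> {w. set w \<subseteq> X \<times> Y \<and> length w \<le> card X}" by simp
  qed
  show "finite {w. set w \<subseteq> X \<times> Y \<and> length w \<le> card X}"
    using assms by (intro finite_lists_length_le) simp
qed

text \<open>As \<open>x0\<close> is the smallest column, the step from \<open>u\<close> into
  \<open>(x0, c)\<close> is never a rise, while the step from \<open>(x0, c)\<close> to the head of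
  \<open>v\<close> is a rise exactly when that head lies above row \<open>c\<close>. So the only
  constraint at the junctions is that the head of \<open>v\<close> lies below row
  \<open>c\<close>.\<close>

lemma words_split_iff:
  assumes x0: "\<And>x. x \<in> X \<Longrightarrow> x0 < x"
  shows "u @ (x0, c) # v \<in> words (insert x0 X) Y \<longleftrightarrow>
    c \<in> Y \<and> fst ` set v \<subseteq> X \<and> snd ` set v \<subseteq> Y - {c} \<and>
    v \<in> words (fst ` set v) (snd ` set v) \<and>
    u \<in> words (X - fst ` set v) (Y - {c} - snd ` set v) \<and> (v = [] \<or> snd (hd v) < c)"
    (is "?L \<longleftrightarrow> ?R")
proof
  have x0X: "x0 \<notin> X" using x0 by blast
  assume L: ?L
  define U V U' V' where "U = fst ` set u" and "V = fst ` set v" and "U' = snd ` set u" and "V' = snd ` set v"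
  have dx: "U \<inter> V = {}" "x0 \<notin> U" "x0 \<notin> V" "U \<union> insert x0 V = insert x0 X"
    using L unfolding words_def U_def V_def by auto
  have dy: "U' \<inter> V' = {}" "c \<notin> U'" "c \<notin> V'" "U' \<union> insert c V' = Y"
    using L unfolding words_def U'_def V'_def by auto
  have X: "X = U \<union> V" "X - V = U" using dx x0X by auto
  have Y: "Y - {c} - V' = U'" "V' \<subseteq> Y - {c}" "c \<in> Y" using dy by auto
  have sub: "distinct (map fst u)" "distinct (map fst v)" "distinct (map snd u)" "distinct (map snd v)"
    "successively no_rise u" "successively no_rise v" "v \<noteq> [] \<Longrightarrow> no_rise (x0, c) (hd v)"
    using L by (auto simp: words_def successively_append_iff successively_Cons)
  have "snd (hd v) < c" if "v \<noteq> []"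
  proof -
    have "hd v \<in> set v" using that by simp
    then have "fst (hd v) \<in> V" "snd (hd v) \<in> V'" by (auto simp: V_def V'_def)
    then have "x0 < fst (hd v)" "snd (hd v) \<noteq> c" using X x0 dy by auto
    then show ?thesis using sub(7)[OF that] by (simp add: no_rise_def)
  qed
  then show ?R
    using sub X Y unfolding words_def U_def[symmetric] V_def[symmetric] U'_def[symmetric] V'_def[symmetric]
    by (auto simp: U_def V_def U'_def V'_def)
next
  assume R: ?R
  have u: "fst ` set u = X - fst ` set v" "snd ` set u = Y - {c} - snd ` set v"
    using R by (auto simp: words_def)
  have "x0 \<notin> X" "fst ` set v \<subseteq> X" using R x0 by blast+
  then have xu: "x0 \<notin> fst ` set u" "x0 \<notin> fst ` set v" using u(1) by (auto simp only: Diff_iff dest: subsetD)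
  have "x0 < fst (last u)" if "u \<noteq> []"
  proof -
    have "fst (last u) \<in> fst ` set u" using that by simp
    then show ?thesis using u(1) x0 by blast
  qed
  then have "u \<noteq> [] \<Longrightarrow> no_rise (last u) (x0, c)" by (auto simp: no_rise_def)
  moreover have "v \<noteq> [] \<Longrightarrow> no_rise (x0, c) (hd v)" using R by (auto simp: no_rise_def)
  ultimately have "successively no_rise (u @ (x0, c) # v)"
    using R by (auto simp: words_def successively_append_iff successively_Cons)
  moreover have "distinct (map fst (u @ (x0, c) # v))"
    using R u(1) xu by (auto simp: words_def)
  moreover have "distinct (map snd (u @ (x0, c) # v))"
  proof -
    have "c \<notin> snd ` set u" "c \<notin> snd ` set v" "snd ` set u \<inter> snd ` set v = {}" using R u(2) by auto
    then show ?thesis using R by (simp add: words_def)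
  qed
  moreover have "fst ` set (u @ (x0, c) # v) = insert x0 X"
  proof -
    have "fst ` set (u @ (x0, c) # v) = insert x0 (fst ` set u \<union> fst ` set v)" by auto
    then show ?thesis using R u(1) by auto
  qed
  moreover have "snd ` set (u @ (x0, c) # v) = Y"
  proof -
    have "snd ` set (u @ (x0, c) # v) = insert c (snd ` set u \<union> snd ` set v)" by auto
    then show ?thesis using R u(2) by auto
  qed
  ultimately show ?L by (simp add: words_def)
qed

text \<open>The sets \<open>X1\<close> and \<open>Y1\<close> are the columns and rows of the factor
  \<open>v\<close> after the point in column \<open>x0\<close>. The head of the whole word is the
  head of \<open>u\<close>, or \<open>(x0, c)\<close> if \<open>u\<close> is empty; hence the
  condition \<open>u = [] \<longrightarrow> c < d\<close>.\<close>

lemma card_words_step: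
  assumes fin: "finite X" "finite Y" and x0: "\<And>x. x \<in> X \<Longrightarrow> x0 < x"
  shows "card {w \<in> words (insert x0 X) Y. w = [] \<or> snd (hd w) < d} =
    (\<Sum>c\<in>Y. \<Sum>(X1, Y1)\<in>Pow X \<times> Pow (Y - {c}). card {v \<in> words X1 Y1. v = [] \<or> snd (hd v) < c} *
       card {u \<in> words (X - X1) (Y - {c} - Y1). (u = [] \<or> snd (hd u) < d) \<and> (u = [] \<longrightarrow> c < d)})"
proof -
  let ?V = "\<lambda>c X1 Y1. {v \<in> words X1 Y1. v = [] \<or> snd (hd v) < c}"
  let ?U = "\<lambda>c X1 Y1. {u \<in> words (X - X1) (Y - {c} - Y1). (u = [] \<or> snd (hd u) < d) \<and> (u = [] \<longrightarrow> c < d)}"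
  let ?N = "\<lambda>c. Sigma (Pow X \<times> Pow (Y - {c})) (\<lambda>(X1, Y1). ?V c X1 Y1 \<times> ?U c X1 Y1)"
  let ?f = "\<lambda>(c, (X1 :: nat set, Y1 :: nat set), v, u). u @ (x0, c) # v"
  let ?T = "{w \<in> words (insert x0 X) Y. w = [] \<or> snd (hd w) < d}"
  \<comment> \<open>The index \<open>(X1, Y1)\<close> is determined by \<open>v\<close>, so the data
    amount to a word together with a splitting at its point in column \<open>x0\<close>.\<close>
  have N: "(c, (X1, Y1), v, u) \<in> Sigma Y ?N \<longleftrightarrow> X1 = fst ` set v \<and> Y1 = snd ` set v \<and> u @ (x0, c) # v \<in> ?T"
    for c X1 Y1 v u
  proof -
    have v: "v \<in> words X1 Y1 \<longleftrightarrow> X1 = fst ` set v \<and> Y1 = snd ` set v \<and> v \<in> words (fst ` set v) (snd ` set v)"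
      by (auto simp: words_def)
    have hd: "snd (hd (u @ (x0, c) # v)) < d \<longleftrightarrow> (u = [] \<or> snd (hd u) < d) \<and> (u = [] \<longrightarrow> c < d)"
      by (cases u) auto
    have "(c, (X1, Y1), v, u) \<in> Sigma Y ?N \<longleftrightarrow> c \<in> Y \<and> X1 \<subseteq> X \<and> Y1 \<subseteq> Y - {c} \<and> v \<in> words X1 Y1 \<and>
        (v = [] \<or> snd (hd v) < c) \<and> u \<in> words (X - X1) (Y - {c} - Y1) \<and>
        snd (hd (u @ (x0, c) # v)) < d"
      unfolding hd by auto
    also have "\<dots> \<longleftrightarrow> X1 = fst ` set v \<and> Y1 = snd ` set v \<and> u @ (x0, c) # v \<in> words (insert x0 X) Y \<and>
        snd (hd (u @ (x0, c) # v)) < d"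
    proof (cases "X1 = fst ` set v \<and> Y1 = snd ` set v")
      case True
      have "u @ (x0, c) # v \<in> words (insert x0 X) Y \<longleftrightarrow>
          c \<in> Y \<and> X1 \<subseteq> X \<and> Y1 \<subseteq> Y - {c} \<and> v \<in> words X1 Y1 \<and>
          u \<in> words (X - X1) (Y - {c} - Y1) \<and> (v = [] \<or> snd (hd v) < c)"
        using words_split_iff[of X x0 u c v Y] x0 True by simp
      then show ?thesis using True by argo
    next
      case False
      then show ?thesis using v by argo
    qed
    finally show ?thesis by simp
  qed
  have inj: "inj_on ?f (Sigma Y ?N)"
  proof (rule inj_onI)
    fix p q assume pq: "p \<in> Sigma Y ?N" "q \<in> Sigma Y ?N" "?f p = ?f q"
    obtain c X1 Y1 v u where p: "p = (c, (X1, Y1), v, u)" by (metis surj_pair)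
    obtain c' X1' Y1' v' u' where q: "q = (c', (X1', Y1'), v', u')" by (metis surj_pair)
    note p' = pq(1)[unfolded p N] and q' = pq(2)[unfolded q N]
    have eq: "u @ (x0, c) # v = u' @ (x0, c') # v'" using pq(3) p q by simp
    have d: "distinct (map fst (u @ (x0, c) # v))" using p' by (simp add: words_def)
    \<comment> \<open>First coordinates are distinct, so there is only one point in column
      \<open>x0\<close> at which the word can be split.\<close>
    have "(x0, c') \<in> set (u @ (x0, c) # v)" unfolding eq by simp
    then have c: "c = c'" using d by (force simp: rev_image_eqI)
    have nin: "(x0, c) \<notin> set u" "(x0, c) \<notin> set v" using d by (auto simp: rev_image_eqI)
    have "u = u' \<and> v = v'"
      using eq append_Cons_eq_iff[OF nin, of u' v'] unfolding c by simp
    then show "p = q" using p q c p' q' by simp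
  qed
  have img: "?f ` Sigma Y ?N = ?T"
  proof (intro equalityI subsetI)
    fix w assume "w \<in> ?f ` Sigma Y ?N"
    then obtain p where p: "p \<in> Sigma Y ?N" "w = ?f p" by (rule imageE)
    obtain c X1 Y1 v u where p': "p = (c, (X1, Y1), v, u)" by (metis surj_pair)
    show "w \<in> ?T" using p(1)[unfolded p' N] p(2) p' by simp
  next
    fix w assume w: "w \<in> ?T"
    then have "x0 \<in> fst ` set w" by (simp add: words_def)
    then obtain c where "(x0, c) \<in> set w" by force
    then obtain u v where w': "w = u @ (x0, c) # v" by (meson split_list)
    then have "(c, (fst ` set v, snd ` set v), v, u) \<in> Sigma Y ?N" using w unfolding N by simp
    then show "w \<in> ?f ` Sigma Y ?N" by (rule rev_image_eqI) (simp add: w')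
  qed
  have finVU: "finite (?V c X1 Y1)" "finite (?U c X1 Y1)" if "X1 \<subseteq> X" "Y1 \<subseteq> Y - {c}" for c X1 Y1
  proof -
    have "finite X1" "finite Y1" using that fin finite_subset by blast+
    then show "finite (?V c X1 Y1)" "finite (?U c X1 Y1)"
      using fin finite_words[of X1 Y1] finite_words[of "X - X1" "Y - {c} - Y1"] by simp_all
  qed
  have "card ?T = card (Sigma Y ?N)" using card_image[OF inj] unfolding img .
  also have "\<dots> = (\<Sum>c\<in>Y. card (?N c))"
    using fin finVU by (intro card_SigmaI ballI finite_SigmaI) auto
  also have "\<dots> = (\<Sum>c\<in>Y. \<Sum>q\<in>Pow X \<times> Pow (Y - {c}). card (case q of (X1, Y1) \<Rightarrow> ?V c X1 Y1 \<times> ?U c X1 Y1))"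
    using fin finVU by (intro sum.cong refl card_SigmaI ballI) auto
  also have "\<dots> = (\<Sum>c\<in>Y. \<Sum>(X1, Y1)\<in>Pow X \<times> Pow (Y - {c}). card (?V c X1 Y1) * card (?U c X1 Y1))"
    by (intro sum.cong refl) (auto simp: card_cartesian_product)
  finally show ?thesis .
qed

section \<open>Equality of the two counts by induction on the columns\<close>

text \<open>Both counts satisfy the same recursion, with the marked part in the role of
  \<open>v\<close> and the unmarked part in the role of \<open>u\<close>. The rows and the bound
  vary in the induction, since \<open>v\<close> is bounded by \<open>c\<close> and \<open>u\<close>
  by \<open>d\<close>. The columns of the factors are arbitrary subsets of \<open>X'\<close>, whence
  the induction over proper subsets.\<close>

lemma card_forests_eq_card_words:
  assumes "finite X" "finite Y"
  shows "card {A \<in> cforests X Y. \<forall>z\<in>root_rows A. z < d} = card {w \<in> words X Y. w = [] \<or> snd (hd w) < d}"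
  using assms
proof (induction X arbitrary: Y d rule: finite_psubset_induct)
  case (psubset X)
  show ?case
  proof (cases "X = {}")
    case True
    have "cforests {} Y = (if Y = {} then {{}} else {})"
      by (auto simp: cforests_def nonamb_def balanced_def)
    moreover have "words {} Y = (if Y = {} then {[]} else {})"
      by (auto simp: words_def)
    ultimately show ?thesis using True
      by (simp add: root_rows_def Collect_conv_if)
  next
    case False
    define x0 where "x0 = Min X"
    define X' where "X' = X - {x0}"
    have X: "X = insert x0 X'" and finX': "finite X'" and sub: "X' \<subset> X"
    proof -
      have "x0 \<in> X" using False psubset.hyps(1) unfolding x0_def by simp
      then show "X = insert x0 X'" "finite X'" "X' \<subset> X" using psubset.hyps(1) unfolding X'_def by auto
    qed
    have x0: "x0 < x" if "x \<in> X'" for x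
      using that psubset.hyps(1) unfolding x0_def X'_def by (simp add: less_le)
    have IH: "card {v \<in> words X1 Y1. v = [] \<or> snd (hd v) < e} = card {A \<in> cforests X1 Y1. \<forall>z\<in>root_rows A. z < e}"
      if "X1 \<subseteq> X'" "Y1 \<subseteq> Y" for X1 Y1 e
    proof -
      have "X1 \<subset> X" "finite Y1" using that sub psubset.prems finite_subset by blast+
      then show ?thesis using psubset.IH[of X1 Y1 e] by simp
    qed
    \<comment> \<open>The extra condition matters only for the empty word and for the forest without
      roots. Both occur only for \<open>X1 = {}\<close>; then both sides count nothing unless
      \<open>c < d\<close>.\<close>
    have IH': "card {u \<in> words X1 Y1. (u = [] \<or> snd (hd u) < d) \<and> (u = [] \<longrightarrow> c < d)} =
        card {A \<in> cforests X1 Y1. (\<forall>z\<in>root_rows A. z < d) \<and> (root_rows A = {} \<longrightarrow> c < d)}"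
      if "X1 \<subseteq> X'" "Y1 \<subseteq> Y" for X1 Y1 c
    proof (cases "X1 = {} \<and> \<not> c < d")
      case True
      have "u = []" if "u \<in> words {} Y1" for u using that by (auto simp: words_def)
      moreover have "root_rows A = {}" if "A \<in> cforests {} Y1" for A
        using that by (auto simp: cforests_def root_rows_def)
      ultimately have "{u \<in> words X1 Y1. (u = [] \<or> snd (hd u) < d) \<and> (u = [] \<longrightarrow> c < d)} = {}"
        "{A \<in> cforests X1 Y1. (\<forall>z\<in>root_rows A. z < d) \<and> (root_rows A = {} \<longrightarrow> c < d)} = {}"
        using True by auto
      then show ?thesis by (simp only: card.empty)
    next
      case False
      have "u = [] \<longrightarrow> c < d" if "u \<in> words X1 Y1" for u using that False by (auto simp: words_def)
      moreover have "root_rows A = {} \<longrightarrow> c < d" if "A \<in> cforests X1 Y1" for A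
        using root_rows_nonempty[OF that] False by blast
      ultimately show ?thesis using IH[OF that, of d] by (simp cong: conj_cong)
    qed
    have "card {w \<in> words X Y. w = [] \<or> snd (hd w) < d} =
      (\<Sum>c\<in>Y. \<Sum>(X1, Y1)\<in>Pow X' \<times> Pow (Y - {c}). card {v \<in> words X1 Y1. v = [] \<or> snd (hd v) < c} *
       card {u \<in> words (X' - X1) (Y - {c} - Y1). (u = [] \<or> snd (hd u) < d) \<and> (u = [] \<longrightarrow> c < d)})"
      unfolding X by (rule card_words_step[OF finX' psubset.prems x0])
    also have "\<dots> = (\<Sum>c\<in>Y. \<Sum>(X1, Y1)\<in>Pow X' \<times> Pow (Y - {c}). card {A \<in> cforests X1 Y1. \<forall>z\<in>root_rows A. z < c} *
       card {A \<in> cforests (X' - X1) (Y - {c} - Y1). (\<forall>z\<in>root_rows A. z < d) \<and> (root_rows A = {} \<longrightarrow> c < d)})"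
    proof (intro sum.cong refl)
      fix c q assume "q \<in> Pow X' \<times> Pow (Y - {c})"
      then obtain X1 Y1 where q: "q = (X1, Y1)" "X1 \<subseteq> X'" "Y1 \<subseteq> Y - {c}" by auto
      have "X' - X1 \<subseteq> X'" "Y - {c} - Y1 \<subseteq> Y" "Y1 \<subseteq> Y" using q by auto
      then show "(case q of (X1, Y1) \<Rightarrow> card {v \<in> words X1 Y1. v = [] \<or> snd (hd v) < c} *
          card {u \<in> words (X' - X1) (Y - {c} - Y1). (u = [] \<or> snd (hd u) < d) \<and> (u = [] \<longrightarrow> c < d)}) =
        (case q of (X1, Y1) \<Rightarrow> card {A \<in> cforests X1 Y1. \<forall>z\<in>root_rows A. z < c} *
          card {A \<in> cforests (X' - X1) (Y - {c} - Y1). (\<forall>z\<in>root_rows A. z < d) \<and> (root_rows A = {} \<longrightarrow> c < d)})"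
        unfolding q(1) prod.case using IH[of X1 Y1 c] IH'[of "X' - X1" "Y - {c} - Y1" c] q(2) by presburger
    qed
    \<comment> \<open>Here \<open>P\<close> bounds the marks by \<open>c\<close>, and
      \<open>Q\<close> is the condition on the unmarked roots that corresponds to the one on
      \<open>u\<close>.\<close>
    also have "\<dots> = (\<Sum>c\<in>Y. card {(B, C). B \<in> cforests X' (Y - {c}) \<and> C \<subseteq> root_rows B \<and> (\<forall>z\<in>C. z < c) \<and>
       ((\<forall>z\<in>root_rows B - C. z < d) \<and> (root_rows B - C = {} \<longrightarrow> c < d))})"
      using finX' psubset.prems by (intro sum.cong refl card_marked_forests[symmetric]) auto
    also have "\<dots> = (\<Sum>c\<in>Y. card {(B, C). B \<in> cforests X' (Y - {c}) \<and> C \<subseteq> root_rows B \<and> (\<forall>z\<in>C. z < c) \<and>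
       (\<forall>z\<in>root_rows B - C. z < d) \<and> (\<exists>z\<in>insert c C. z < d)})"
      by (intro sum.cong refl card_swap_marks[symmetric])
    also have "\<dots> = card {A \<in> cforests X Y. \<forall>z\<in>root_rows A. z < d}"
      unfolding X by (rule card_forests_step[OF finX' psubset.prems x0, symmetric])
    finally show ?thesis by (rule sym)
  qed
qed


subsection \<open>The two families of the theorem\<close>

lemma least_elements:
  fixes U :: "nat set"
  assumes "finite U"
  shows "{b \<in> U. \<forall>b'\<in>U. b \<le> b'} = (if U = {} then {} else {Min U})"
proof (cases "U = {}")
  case False
  then have "Min U \<in> U" "\<And>b. b \<in> U \<Longrightarrow> Min U \<le> b" using assms by auto
  then show ?thesis using False by (auto intro!: antisym)
qed simp

lemma no_both_iff_nonamb:
  "\<not> (\<exists>p\<in>A. same_x_below A p \<noteq> {} \<and> same_y_before A p \<noteq> {}) \<longleftrightarrow> nonamb A"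
proof -
  have "same_x_below A (x, y) \<noteq> {} \<longleftrightarrow> (\<exists>y'. (x, y') \<in> A \<and> y' < y)" for x y
    by (force simp: same_x_below_def)
  moreover have "same_y_before A (x, y) \<noteq> {} \<longleftrightarrow> (\<exists>x'. (x', y) \<in> A \<and> x' < x)" for x y
    by (force simp: same_y_before_def)
  ultimately show ?thesis unfolding nonamb_def Bex_def split_paired_Ex by blast
qed

text \<open>By non-ambiguity at most one of the two candidate sets is nonempty, so the nested
  \<open>if\<close> becomes a disjunction symmetric in columns and rows.\<close>

lemma parent_eq_Some_iff:
  assumes "finite A" "nonamb A" "(a, b) \<in> A"
  shows "parent A (a, b) = Some (x, y) \<longleftrightarrow>
    a = x \<and> (x, y) \<in> A \<and> y < b \<and> (\<forall>y'. (x, y') \<in> A \<longrightarrow> y' < b \<longrightarrow> y' \<le> y) \<or>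
    b = y \<and> (x, y) \<in> A \<and> x < a \<and> (\<forall>x'. (x', y) \<in> A \<longrightarrow> x' < a \<longrightarrow> x' \<le> x)"
proof -
  define D where "D = snd ` same_x_below A (a, b)"
  define L where "L = fst ` same_y_before A (a, b)"
  have D: "D = {y. (a, y) \<in> A \<and> y < b}" by (force simp: D_def same_x_below_def)
  have L: "L = {x. (x, b) \<in> A \<and> x < a}" by (force simp: L_def same_y_before_def)
  have fin: "finite D" "finite L"
    using assms(1) by (auto simp: D_def L_def same_x_below_def same_y_before_def)
  have dis: "D = {} \<or> L = {}" using assms(2,3) unfolding D L nonamb_def by blast
  have "parent A (a, b) = (if D \<noteq> {} then Some (a, Max D) else if L \<noteq> {} then Some (Max L, b) else None)"
    by (simp add: parent_def D_def L_def)
  then have "parent A (a, b) = Some (x, y) \<longleftrightarrow>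
      a = x \<and> D \<noteq> {} \<and> Max D = y \<or> b = y \<and> L \<noteq> {} \<and> Max L = x"
    using dis by auto
  moreover have "D \<noteq> {} \<and> Max D = y \<longleftrightarrow> y \<in> D \<and> (\<forall>y'\<in>D. y' \<le> y)"
    using Max_eq_iff[OF fin(1)] by (cases "D = {}") auto
  then have "D \<noteq> {} \<and> Max D = y \<longleftrightarrow> (a, y) \<in> A \<and> y < b \<and> (\<forall>y'. (a, y') \<in> A \<longrightarrow> y' < b \<longrightarrow> y' \<le> y)"
    unfolding D by blast
  moreover have "L \<noteq> {} \<and> Max L = x \<longleftrightarrow> x \<in> L \<and> (\<forall>x'\<in>L. x' \<le> x)"
    using Max_eq_iff[OF fin(2)] by (cases "L = {}") auto
  then have "L \<noteq> {} \<and> Max L = x \<longleftrightarrow> (x, b) \<in> A \<and> x < a \<and> (\<forall>x'. (x', b) \<in> A \<longrightarrow> x' < a \<longrightarrow> x' \<le> x)"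
    unfolding L by blast
  ultimately show ?thesis by (simp cong: conj_cong)
qed

lemma card_children:
  assumes "finite A" "nonamb A" "(x, y) \<in> A"
  shows "card (children A (x, y)) =
    (if \<exists>y'>y. (x, y') \<in> A then 1 else 0) + (if \<exists>x'>x. (x', y) \<in> A then 1 else 0)"
proof -
  define U where "U = {y'. (x, y') \<in> A \<and> y < y'}"
  define V where "V = {x'. (x', y) \<in> A \<and> x < x'}"
  have "U \<subseteq> snd ` A" "V \<subseteq> fst ` A" by (force simp: U_def V_def)+
  then have fin: "finite U" "finite V" using assms(1) finite_subset by blast+
  have "children A (x, y) = Pair x ` {b \<in> U. \<forall>b'\<in>U. b \<le> b'} \<union> (\<lambda>a. (a, y)) ` {a \<in> V. \<forall>a'\<in>V. a \<le> a'}"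
  proof (intro set_eqI)
    fix p :: point
    obtain a b where p: "p = (a, b)" by (cases p)
    have "p \<in> children A (x, y) \<longleftrightarrow> (a, b) \<in> A \<and>
        (a = x \<and> y < b \<and> (\<forall>y'. (x, y') \<in> A \<longrightarrow> y' < b \<longrightarrow> y' \<le> y) \<or>
         b = y \<and> x < a \<and> (\<forall>x'. (x', y) \<in> A \<longrightarrow> x' < a \<longrightarrow> x' \<le> x))"
      using parent_eq_Some_iff[OF assms(1,2), of a b x y] assms(3) unfolding p children_def by auto
    \<comment> \<open>That \<open>y\<close> is the largest entry below \<open>b\<close> means that
      \<open>b\<close> is the smallest entry above \<open>y\<close>, and likewise in the
      row.\<close>
    also have "\<dots> \<longleftrightarrow> a = x \<and> b \<in> U \<and> (\<forall>b'\<in>U. b \<le> b') \<or> b = y \<and> a \<in> V \<and> (\<forall>a'\<in>V. a \<le> a')"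
      unfolding U_def V_def mem_Collect_eq Ball_def by (metis not_le)
    also have "\<dots> \<longleftrightarrow> p \<in> Pair x ` {b \<in> U. \<forall>b'\<in>U. b \<le> b'} \<union> (\<lambda>a. (a, y)) ` {a \<in> V. \<forall>a'\<in>V. a \<le> a'}"
      unfolding p by auto
    finally show "p \<in> children A (x, y) \<longleftrightarrow> \<dots>" .
  qed
  \<comment> \<open>The child above and the child to the right are different points, so they are
    counted separately.\<close>
  moreover have "Min U \<noteq> y" if "U \<noteq> {}" using Min_in[OF fin(1) that] by (auto simp: U_def)
  ultimately have "card (children A (x, y)) = (if U = {} then 0 else 1) + (if V = {} then 0 else 1)"
    unfolding least_elements[OF fin(1)] least_elements[OF fin(2)]
    by (cases "U = {}"; cases "V = {}") (auto simp: card_insert_if)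
  moreover have "U = {} \<longleftrightarrow> \<not> (\<exists>y'>y. (x, y') \<in> A)" "V = {} \<longleftrightarrow> \<not> (\<exists>x'>x. (x', y) \<in> A)"
    by (auto simp: U_def V_def)
  ultimately show ?thesis by simp
qed

lemma complete_forest_iff_balanced:
  assumes "finite A" "nonamb A"
  shows "complete_forest A \<longleftrightarrow> balanced A"
proof -
  have "(card (children A (x, y)) = 0 \<or> card (children A (x, y)) = 2) \<longleftrightarrow>
      ((\<exists>y'>y. (x, y') \<in> A) \<longleftrightarrow> (\<exists>x'>x. (x', y) \<in> A))" if "(x, y) \<in> A" for x y
    unfolding card_children[OF assms that] by (simp; blast)
  then show ?thesis
    unfolding complete_forest_def balanced_def Ball_def split_paired_All
    by (intro iff_allI imp_cong refl)
qed

lemma leaves_eq: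
  assumes "finite A" "nonamb A" "balanced A"
  shows "leaves A = {(x, y) \<in> A. \<not> (\<exists>y'>y. (x, y') \<in> A)}" "leaves A = {(x, y) \<in> A. \<not> (\<exists>x'>x. (x', y) \<in> A)}"
proof -
  have bal: "(\<exists>y'>y. (x, y') \<in> A) \<longleftrightarrow> (\<exists>x'>x. (x', y) \<in> A)" if "(x, y) \<in> A" for x y
    using assms(3) that unfolding balanced_def by blast
  have "finite (children A p)" for p using assms(1) by (simp add: children_def)
  then have ch: "children A (x, y) = {} \<longleftrightarrow> \<not> (\<exists>y'>y. (x, y') \<in> A)" if "(x, y) \<in> A" for x y
    using card_children[OF assms(1,2) that] bal[OF that] by (simp flip: card_0_eq)
  show "leaves A = {(x, y) \<in> A. \<not> (\<exists>y'>y. (x, y') \<in> A)}"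
    unfolding leaves_def using ch by auto
  also have "\<dots> = {(x, y) \<in> A. \<not> (\<exists>x'>x. (x', y) \<in> A)}"
    using bal by fast
  finally show "leaves A = {(x, y) \<in> A. \<not> (\<exists>x'>x. (x', y) \<in> A)}" .
qed

text \<open>Of the two descriptions of leaves, the first gives exactly one leaf in each column, its
  topmost point, and the second exactly one in each row, its rightmost point.\<close>

lemma card_leaves:
  assumes "finite A" "nonamb A" "balanced A"
  shows "card (leaves A) = card (fst ` A)" "card (leaves A) = card (snd ` A)"
proof -
  note l = leaves_eq[OF assms]
  have "inj_on fst (leaves A)" unfolding l(1) by (auto simp: inj_on_def) (metis linorder_neqE_nat)
  moreover have "fst ` leaves A = fst ` A"
  proof
    show "fst ` A \<subseteq> fst ` leaves A"
    proof
      fix x assume "x \<in> fst ` A"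
      define K where "K = {y. (x, y) \<in> A}"
      have "K \<subseteq> snd ` A" by (force simp: K_def)
      then have K: "finite K" "K \<noteq> {}" using assms(1) \<open>x \<in> fst ` A\<close> finite_subset by (auto simp: K_def)
      have "(x, Max K) \<in> A" using Max_in[OF K] by (simp add: K_def)
      moreover have "\<not> (\<exists>y'>Max K. (x, y') \<in> A)" using Max_ge[OF K(1)] by (auto simp: K_def not_less)
      ultimately show "x \<in> fst ` leaves A" unfolding l(1) by force
    qed
  qed (auto simp: leaves_def)
  ultimately show "card (leaves A) = card (fst ` A)" using card_image by metis
  have "inj_on snd (leaves A)" unfolding l(2) by (auto simp: inj_on_def) (metis linorder_neqE_nat)
  moreover have "snd ` leaves A = snd ` A"
  proof
    show "snd ` A \<subseteq> snd ` leaves A"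
    proof
      fix y assume "y \<in> snd ` A"
      define K where "K = {x. (x, y) \<in> A}"
      have "K \<subseteq> fst ` A" by (force simp: K_def)
      then have K: "finite K" "K \<noteq> {}" using assms(1) \<open>y \<in> snd ` A\<close> finite_subset by (auto simp: K_def)
      have "(Max K, y) \<in> A" using Max_in[OF K] by (simp add: K_def)
      moreover have "\<not> (\<exists>x'>Max K. (x', y) \<in> A)" using Max_ge[OF K(1)] by (auto simp: K_def not_less)
      ultimately show "y \<in> snd ` leaves A" unfolding l(2) by force
    qed
  qed (auto simp: leaves_def)
  ultimately show "card (leaves A) = card (snd ` A)" using card_image by metis
qed

lemma initial_segment_eq:
  fixes S :: "nat set"
  assumes "finite S" "\<forall>x\<in>S. 1 \<le> x" "\<forall>x\<in>S. \<forall>x'. 1 \<le> x' \<and> x' < x \<longrightarrow> x' \<in> S"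
  shows "S = {1..card S}"
proof -
  obtain m where "S = {1..m}"
  proof (cases "S = {}")
    case False
    then have "Max S \<in> S" "\<And>x. x \<in> S \<Longrightarrow> x \<le> Max S" using assms(1) by auto
    then have mem: "x \<in> S \<longleftrightarrow> 1 \<le> x \<and> x \<le> Max S" for x using assms(2,3) by (metis le_neq_implies_less)
    have "S = {1..Max S}" by (rule set_eqI) (simp only: mem atLeastAtMost_iff)
    then show ?thesis by (rule that)
  qed (use that[of 0] in simp)
  then show ?thesis by simp
qed

text \<open>Having \<open>n\<close> leaves means having \<open>n\<close> columns and
  \<open>n\<close> rows, and the condition that no column or row is skipped makes both sets equal to
  \<open>{1..n}\<close>.\<close>

lemma complete_nonambiguous_forests_eq: "complete_nonambiguous_forests n = cforests {1..n} {1..n}"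
proof (intro set_eqI iffI)
  fix A assume "A \<in> complete_nonambiguous_forests n"
  then have na: "nonambiguous_forest A" and co: "complete_forest A" and n: "card (leaves A) = n"
    by (auto simp: complete_nonambiguous_forests_def)
  have fin: "finite A" and nb: "nonamb A"
    using na no_both_iff_nonamb[of A] unfolding nonambiguous_forest_def by blast+
  have ba: "balanced A" using co complete_forest_iff_balanced[OF fin nb] by simp
  have "fst ` A = {1..card (fst ` A)}"
    using na fin unfolding nonambiguous_forest_def by (intro initial_segment_eq) (simp_all, blast)
  moreover have "snd ` A = {1..card (snd ` A)}"
    using na fin unfolding nonambiguous_forest_def by (intro initial_segment_eq) (simp_all, blast)
  ultimately show "A \<in> cforests {1..n} {1..n}"
    using nb ba n card_leaves[OF fin nb ba] by (simp add: cforests_def)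
next
  fix A assume "A \<in> cforests {1..n} {1..n}"
  then have XY: "fst ` A = {1..n}" "snd ` A = {1..n}" and nb: "nonamb A" and ba: "balanced A"
    by (auto simp: cforests_def)
  have "A \<subseteq> fst ` A \<times> snd ` A" by force
  then have fin: "finite A" unfolding XY by (rule finite_subset) simp
  have x: "x \<in> fst ` A \<longleftrightarrow> 1 \<le> x \<and> x \<le> n" and y: "x \<in> snd ` A \<longleftrightarrow> 1 \<le> x \<and> x \<le> n" for x
    unfolding XY by auto
  have "\<exists>q\<in>A. fst q = x'" if "p \<in> A" "1 \<le> x'" "x' < fst p" for p x'
  proof -
    have "x' \<in> fst ` A" using that x[of "fst p"] imageI[OF that(1), of fst] unfolding x by simp
    then show ?thesis by blast
  qed
  moreover have "\<exists>q\<in>A. snd q = y'" if "p \<in> A" "1 \<le> y'" "y' < snd p" for p y'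
  proof -
    have "y' \<in> snd ` A" using that y[of "snd p"] imageI[OF that(1), of snd] unfolding y by simp
    then show ?thesis by blast
  qed
  moreover have "1 \<le> fst p \<and> 1 \<le> snd p" if "p \<in> A" for p
    using that x[of "fst p"] y[of "snd p"] by simp
  ultimately have "nonambiguous_forest A"
    using fin nb no_both_iff_nonamb[of A] unfolding nonambiguous_forest_def by blast
  then show "A \<in> complete_nonambiguous_forests n"
    using complete_forest_iff_balanced[OF fin nb] ba card_leaves(1)[OF fin nb ba] XY
    by (simp add: complete_nonambiguous_forests_def)
qed

section \<open>Pairs of permutations as words\<close>

lemma successively_upt_iff:
  "successively P [1..<Suc n] \<longleftrightarrow> (\<forall>i. 1 \<le> i \<and> i < n \<longrightarrow> P i (i + 1))"
proof (induction n)
  case (Suc n)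
  have "successively P [1..<Suc (Suc n)] \<longleftrightarrow> successively P [1..<Suc n] \<and> (1 \<le> n \<longrightarrow> P n (n + 1))"
    by (cases n) (auto simp: successively_append_iff)
  also have "\<dots> \<longleftrightarrow> (\<forall>i. 1 \<le> i \<and> i < Suc n \<longrightarrow> P i (i + 1))"
    unfolding Suc.IH less_Suc_eq by blast
  finally show ?case .
qed simp

lemma bij_betw_perm_pairs_words:
  "bij_betw (\<lambda>(a, b). map (\<lambda>i. (a i, b i)) [1..<Suc n]) (perm_pairs_no_common_rise n) (words {1..n} {1..n})"
proof (rule bij_betw_imageI)
  let ?f = "\<lambda>(a, b). map (\<lambda>i. (a i, b i)) [1..<Suc n]"
  have rise: "successively no_rise (?f (a, b)) \<longleftrightarrow> \<not> (\<exists>i. 1 \<le> i \<and> i < n \<and> common_rise a b i)"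
    for a b :: "nat \<Rightarrow> nat"
    unfolding prod.case successively_map successively_upt_iff no_rise_def common_rise_def by auto
  have set_upt: "set [1..<Suc n] = {1..n}" by auto
  have fsts: "map fst (?f (a, b)) = map a [1..<Suc n]" "map snd (?f (a, b)) = map b [1..<Suc n]"
    for a b :: "nat \<Rightarrow> nat" by (simp_all add: comp_def)
  show "inj_on ?f (perm_pairs_no_common_rise n)"
  proof (rule inj_onI)
    fix p q assume pq: "p \<in> perm_pairs_no_common_rise n" "q \<in> perm_pairs_no_common_rise n" "?f p = ?f q"
    obtain a b a' b' where ab: "p = (a, b)" "q = (a', b')" by (cases p, cases q)
    have "a permutes {1..n}" "b permutes {1..n}" "a' permutes {1..n}" "b' permutes {1..n}"
      using pq ab by (auto simp: perm_pairs_no_common_rise_def)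
    moreover have "a i = a' i \<and> b i = b' i" if "i \<in> {1..n}" for i
      using pq(3) that unfolding ab prod.case map_eq_conv set_upt by blast
    ultimately have "a i = a' i \<and> b i = b' i" for i
      by (cases "i \<in> {1..n}") (simp_all add: permutes_not_in)
    then show "p = q" unfolding ab by auto
  qed
  show "?f ` perm_pairs_no_common_rise n = words {1..n} {1..n}"
  proof (intro equalityI subsetI)
    fix w assume "w \<in> ?f ` perm_pairs_no_common_rise n"
    then obtain a b where w: "w = ?f (a, b)" and ab: "a permutes {1..n}" "b permutes {1..n}"
      "\<not> (\<exists>i. 1 \<le> i \<and> i < n \<and> common_rise a b i)"
      by (auto simp: perm_pairs_no_common_rise_def)
    have "distinct (map fst w)" "distinct (map snd w)"
      unfolding w fsts using ab permutes_inj_on by (auto simp: distinct_map)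
    moreover have "fst ` set w = {1..n}" "snd ` set w = {1..n}"
      unfolding set_map[symmetric] w fsts unfolding set_map set_upt using ab permutes_image by blast+
    ultimately show "w \<in> words {1..n} {1..n}" using rise[of a b] ab(3) w by (simp add: words_def)
  next
    fix w assume w: "w \<in> words {1..n} {1..n}"
    then have len: "length w = n" using distinct_card[of "map fst w"] by (simp add: words_def)
    \<comment> \<open>List positions start at 0, hence the shift by one; outside
      \<open>{1..n}\<close> the value is \<open>i\<close>, as \<open>permutes\<close>
      demands.\<close>
    define a where "a i = (if i \<in> {1..n} then fst (w ! (i - 1)) else i)" for i
    define b where "b i = (if i \<in> {1..n} then snd (w ! (i - 1)) else i)" for i
    have f: "?f (a, b) = w"
      by (rule nth_equalityI) (auto simp: len a_def b_def simp del: upt_Suc)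
    have perm: "g permutes {1..n}" if "g ` {1..n} = {1..n}" "\<And>i. i \<notin> {1..n} \<Longrightarrow> g i = i" for g :: "nat \<Rightarrow> nat"
      using that finite_surj_inj[of "{1..n}" g]
      by (intro bij_imp_permutes bij_betw_imageI) auto
    have "a ` {1..n} = set (map fst (?f (a, b)))" "b ` {1..n} = set (map snd (?f (a, b)))"
      unfolding fsts set_map set_upt by simp_all
    then have "a ` {1..n} = {1..n}" "b ` {1..n} = {1..n}"
      unfolding f using w by (auto simp: words_def)
    then have "a permutes {1..n}" "b permutes {1..n}"
      using perm[of a] perm[of b] unfolding a_def b_def by presburger+
    then have "(a, b) \<in> perm_pairs_no_common_rise n"
      using rise[of a b] w f by (simp add: perm_pairs_no_common_rise_def words_def)
    then show "w \<in> ?f ` perm_pairs_no_common_rise n" by (rule rev_image_eqI) (rule f[symmetric])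
  qed
qed

theorem theorem2:
  fixes n :: nat
  assumes "n \<ge> 1"
  shows "(\<exists>f. bij_betw f (complete_nonambiguous_forests n) (perm_pairs_no_common_rise n)) \<and>
         card (complete_nonambiguous_forests n) = card (perm_pairs_no_common_rise n)"
proof -
  let ?N = "{1..n}"
  \<comment> \<open>With the bound \<open>Suc n\<close>, which exceeds every row, the conditions on
    roots and on heads hold for all forests and words.\<close>
  have "root_rows A \<subseteq> ?N" if "A \<in> cforests ?N ?N" for A
    using root_rows_subset[of A] that by (simp add: cforests_def)
  then have "{A \<in> cforests ?N ?N. \<forall>z\<in>root_rows A. z < Suc n} = cforests ?N ?N"
    by fastforce
  moreover have "w = [] \<or> snd (hd w) < Suc n" if "w \<in> words ?N ?N" for w
  proof (cases "w = []")
    case False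
    then have "snd (hd w) \<in> snd ` set w" by simp
    then show ?thesis using that by (simp add: words_def)
  qed simp
  then have "{w \<in> words ?N ?N. w = [] \<or> snd (hd w) < Suc n} = words ?N ?N" by blast
  ultimately have "card (cforests ?N ?N) = card (words ?N ?N)"
    using card_forests_eq_card_words[of ?N ?N "Suc n"] by simp
  then have card: "card (complete_nonambiguous_forests n) = card (perm_pairs_no_common_rise n)"
    unfolding complete_nonambiguous_forests_eq using bij_betw_same_card[OF bij_betw_perm_pairs_words] by simp
  moreover have "finite (complete_nonambiguous_forests n)"
    unfolding complete_nonambiguous_forests_eq by (rule finite_cforests) simp_all
  moreover have "finite (perm_pairs_no_common_rise n)"
    using bij_betw_finite[OF bij_betw_perm_pairs_words] finite_words[of ?N ?N] by simp
  \<comment> \<open>The bijection itself comes from the equality of two finite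
    cardinalities.\<close>
  ultimately show ?thesis using finite_same_card_bij by blast
qed

end
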